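(* Let $x\ge 0$ be an integer and consider an MPC scheme run by a finite set $P$ of semi-honest parties. The scheme preserves confidentiality of the secrets despite $x$ corrupted parties in the ``distrust all'' model if and only if it preserves confidentiality of the secrets despite $x+1$ corrupted parties in the ``distrust attacker'' model.
   Context: A client outsources a computation on secret values to a finite set $P$ of parties; the client is not itself a party. All parties are semi-honest (they follow the protocol; an attacker passively monitors everything seen by a corrupted party). For each party $p\in P$ let its view be the random variable consisting of all values it holds or receives during the execution. A set $T\subseteq P$ of parties that pools its views obtains confidential information if the joint distribution of the views of the parties in $T$ depends on the client's secrets. Corrupted parties share all their information (views) with all parties. Non-corrupted parties do not share any information beyond what the protocol prescribes. ``Distrust all'' model: no party, corrupted or not, may learn anything about the secrets. Thus the scheme preserves confidentiality despite $x$ corrupted parties if for every set $S\subseteq P$ of at most $x$ corrupted parties and every party $A\in P$ (corrupted or not), $A$ obtains no confidential information from the views of $S\cup\{A\}$. ``Distrust attacker'' model: only corrupted parties (the attacker) must not learn anything about the secrets; a non-corrupted party that learns secrets would not misuse them. Thus the scheme preserves confidentiality despite $x$ corrupted parties if for every set $S\subseteq P$ of at most $x$ corrupted parties, no corrupted party $A\in S$ obtains confidential information from the views of $S$ (if $S$ is empty there is no attacker and nothing to check). *)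

theory Defs
  imports "HOL-Probability.Probability"
begin

text \<open>
  The parties are semi-honest, so an execution is never influenced by which parties are
  corrupted: a scheme assigns to every possible input \<open>s\<close> of the client one probability
  space \<open>exec \<sigma> s\<close> of executions. The client is not among the parties.
  The values that occur in an execution carry labels of type \<open>'i\<close>; a value that is absent in some
  executions (e.g. a message that is not always sent) is modelled by a dedicated outcome in its
  value space.
\<close>

record ('p, 's, 'w, 'i, 'v) scheme =
  parties :: "'p set"
  secrets :: "'s set"
  exec :: "'s \<Rightarrow> 'w measure"
  held :: "'p \<Rightarrow> 'i set"
  received :: "'p \<Rightarrow> 'i set"
  val :: "'i \<Rightarrow> 'w \<Rightarrow> 'v"
  val_space :: "'i \<Rightarrow> 'v measure"

definition known :: "('p, 's, 'w, 'i, 'v) scheme \<Rightarrow> 'p \<Rightarrow> 'i set" where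
  "known \<sigma> p = held \<sigma> p \<union> received \<sigma> p"

definition mpc_scheme :: "('p, 's, 'w, 'i, 'v) scheme \<Rightarrow> bool" where
  "mpc_scheme \<sigma> \<longleftrightarrow>
     finite (parties \<sigma>) \<and>
     (\<forall>s\<in>secrets \<sigma>. prob_space (exec \<sigma> s)) \<and>
     (\<forall>s\<in>secrets \<sigma>. \<forall>p\<in>parties \<sigma>. \<forall>i\<in>known \<sigma> p.
        val \<sigma> i \<in> measurable (exec \<sigma> s) (val_space \<sigma> i))"

definition view :: "('p, 's, 'w, 'i, 'v) scheme \<Rightarrow> 'p \<Rightarrow> 'w \<Rightarrow> 'i \<Rightarrow> 'v" where
  "view \<sigma> p \<omega> = (\<lambda>i\<in>known \<sigma> p. val \<sigma> i \<omega>)"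

definition view_space :: "('p, 's, 'w, 'i, 'v) scheme \<Rightarrow> 'p \<Rightarrow> ('i \<Rightarrow> 'v) measure" where
  "view_space \<sigma> p = PiM (known \<sigma> p) (val_space \<sigma>)"

definition joint_view_distr ::
    "('p, 's, 'w, 'i, 'v) scheme \<Rightarrow> 'p set \<Rightarrow> 's \<Rightarrow> ('p \<Rightarrow> 'i \<Rightarrow> 'v) measure" where
  "joint_view_distr \<sigma> T s =
     distr (exec \<sigma> s) (PiM T (view_space \<sigma>)) (\<lambda>\<omega>. \<lambda>p\<in>T. view \<sigma> p \<omega>)"

definition obtains_confidential_info :: "('p, 's, 'w, 'i, 'v) scheme \<Rightarrow> 'p set \<Rightarrow> bool" where
  "obtains_confidential_info \<sigma> T \<longleftrightarrow>
     (\<exists>s\<in>secrets \<sigma>. \<exists>s'\<in>secrets \<sigma>. joint_view_distr \<sigma> T s \<noteq> joint_view_distr \<sigma> T s')"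

text \<open>
  In both models \<open>S\<close> is the set of corrupted parties. They share their views with every party, so
  a party \<open>A\<close> has the views of \<open>S \<union> {A}\<close> at its disposal; for a corrupted \<open>A\<close> this is \<open>S\<close>.
\<close>

definition confidential_distrust_all :: "('p, 's, 'w, 'i, 'v) scheme \<Rightarrow> nat \<Rightarrow> bool" where
  "confidential_distrust_all \<sigma> x \<longleftrightarrow>
     (\<forall>S. S \<subseteq> parties \<sigma> \<and> card S \<le> x \<longrightarrow>
        (\<forall>A\<in>parties \<sigma>. \<not> obtains_confidential_info \<sigma> (S \<union> {A})))"

definition confidential_distrust_attacker :: "('p, 's, 'w, 'i, 'v) scheme \<Rightarrow> nat \<Rightarrow> bool" where
  "confidential_distrust_attacker \<sigma> x \<longleftrightarrow>
     (\<forall>S. S \<subseteq> parties \<sigma> \<and> card S \<le> x \<longrightarrow>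
        (\<forall>A\<in>S. \<not> obtains_confidential_info \<sigma> S))"

text \<open>The views are random variables, so \<open>joint_view_distr\<close> is a genuine distribution.\<close>

lemma prob_space_joint_view_distr:
  assumes "mpc_scheme \<sigma>" "T \<subseteq> parties \<sigma>" "s \<in> secrets \<sigma>"
  shows "prob_space (joint_view_distr \<sigma> T s)"
proof -
  interpret prob_space "exec \<sigma> s"
    using assms by (simp add: mpc_scheme_def)
  have "view \<sigma> p \<in> measurable (exec \<sigma> s) (view_space \<sigma> p)" if "p \<in> T" for p
    unfolding view_def view_space_def
    using assms that by (intro measurable_restrict) (auto simp: mpc_scheme_def)
  then show ?thesis
    unfolding joint_view_distr_def by (intro prob_space_distr measurable_restrict)
qed

end

theory Submission
  imports Defs
begin

text \<open>Both models forbid leaks to the same family of pooled sets: the nonempty sets of at most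
  \<open>x + 1\<close> parties. Such a set is exactly an \<open>S \<union> {A}\<close> with at most
  \<open>x\<close> parties in \<open>S\<close>. Since corruption does not alter the execution,
  whether a set leaks depends only on its members, not on which of them are corrupted.\<close>

theorem theorem1:
  fixes \<sigma> :: "('p, 's, 'w, 'i, 'v) scheme" and x :: nat
  assumes "mpc_scheme \<sigma>"
  shows "confidential_distrust_all \<sigma> x \<longleftrightarrow> confidential_distrust_attacker \<sigma> (x + 1)"
proof
  assume all: "confidential_distrust_all \<sigma> x"
  show "confidential_distrust_attacker \<sigma> (x + 1)"
    unfolding confidential_distrust_attacker_def
  proof (intro allI impI ballI)
    fix S A
    assume S: "S \<subseteq> parties \<sigma> \<and> card S \<le> x + 1" and A: "A \<in> S"
    have "finite S"
      using S assms by (auto simp: mpc_scheme_def intro: finite_subset)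
    \<comment> \<open>One attacker \<open>A\<close> is recast as the observing party of the other
      model, leaving at most \<open>x\<close> corrupted parties.\<close>
    then have "card (S - {A}) \<le> x"
      using S A by auto
    moreover have "S - {A} \<subseteq> parties \<sigma>" "A \<in> parties \<sigma>"
      using S A by auto
    ultimately have "\<not> obtains_confidential_info \<sigma> ((S - {A}) \<union> {A})"
      using all unfolding confidential_distrust_all_def by metis
    moreover have "(S - {A}) \<union> {A} = S"
      using A by blast
    ultimately show "\<not> obtains_confidential_info \<sigma> S"
      by simp
  qed
next
  assume attacker: "confidential_distrust_attacker \<sigma> (x + 1)"
  show "confidential_distrust_all \<sigma> x"
    unfolding confidential_distrust_all_def
  proof (intro allI impI ballI)
    fix S A
    assume S: "S \<subseteq> parties \<sigma> \<and> card S \<le> x" and A: "A \<in> parties \<sigma>"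
    \<comment> \<open>Here the observer \<open>A\<close> is counted as corrupted; only an upper
      bound holds, since \<open>A\<close> may already lie in \<open>S\<close>.\<close>
    have "card (S \<union> {A}) \<le> x + 1"
      using S card_Un_le[of S "{A}"] by simp
    moreover have "S \<union> {A} \<subseteq> parties \<sigma>" "A \<in> S \<union> {A}"
      using S A by auto
    ultimately show "\<not> obtains_confidential_info \<sigma> (S \<union> {A})"
      using attacker unfolding confidential_distrust_attacker_def by metis
  qed
qed

end
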